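(* Let $(X,\tau,\mathfrak{M},\mu)$ be a topological measure space where the measure $\mu$ is $\sigma$-finite. Then the following statements are equivalent. (1) The measure $\mu$ is Borel regular. (2) For every measurable function $u:X\to\overline{\mathbb{R}}$, there exist a Borel set $N\subseteq X$ and a Borel function $f:X\to\overline{\mathbb{R}}$ such that $\mu(N)=0$ and $f=u$ pointwise in $X\setminus N$.
   Context: $\overline{\mathbb{R}}:=[-\infty,\infty]$ with its usual topology. A topological measure space is a quadruple $(X,\tau,\mathfrak{M},\mu)$ where $(X,\tau)$ is a topological space, $\mathfrak{M}$ is a $\sigma$-algebra of subsets of $X$ containing the Borel $\sigma$-algebra $\mathrm{Borel}_\tau(X)$ (equality is not required), and $\mu:\mathfrak{M}\to[0,\infty]$ is a nonnegative measure. Measurable means with respect to $\mathfrak{M}$; Borel sets and functions are with respect to $\mathrm{Borel}_\tau(X)$. The measure $\mu$ is Borel regular if for every $E\in\mathfrak{M}$ there exists $B\in\mathrm{Borel}_\tau(X)$ with $E\subseteq B$ and $\mu(B)=\mu(E)$. *)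

theory Defs
  imports "HOL-Analysis.Analysis"
begin

(* The library's borel is tied to the type class topological_space; this is its analogue for an
   arbitrary topology on a carrier set. Only the sigma-algebra matters: the measure component
   of sigma is the zero measure. *)
definition borel_of :: "'a topology \<Rightarrow> 'a measure" where
  "borel_of T = sigma (topspace T) {U. openin T U}"

locale topological_measure_space =
  fixes T :: "'a topology" and M :: "'a measure"
  assumes space_eq: "space M = topspace T"
    and borel_subset: "sets (borel_of T) \<subseteq> sets M"

definition borel_regular :: "'a topology \<Rightarrow> 'a measure \<Rightarrow> bool" where
  "borel_regular T M \<longleftrightarrow>
     (\<forall>E\<in>sets M. \<exists>B\<in>sets (borel_of T). E \<subseteq> B \<and> emeasure M B = emeasure M E)"

end

theory Submission
  imports Defs
begin

text \<open>
  Borel regularity allows every measurable set to be enclosed in a Borel set of the same measure.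
  For sets of finite measure the excess is then null, and \<open>\<sigma>\<close>-finiteness extends this to all
  measurable sets, by enclosing countably many pieces of finite measure separately. The excess,
  itself only measurable, is enclosed once more in a Borel null set \<open>N\<close>, so that every measurable
  set agrees with a Borel set off a Borel null set (\<open>measurable_set_eq_off_null\<close>). For a function
  \<open>u\<close> this is applied to the preimages of the members of a countable base of the codomain. Off the
  union of the countably many exceptional sets all these preimages are Borel, so making \<open>u\<close>
  constant on that union gives a Borel function (\<open>measurable_function_eq_off_null\<close>).

  Conversely, if the indicator function of \<open>E\<close> agrees with a Borel function \<open>f\<close> off a Borel null
  set \<open>N\<close>, then \<open>{f = 1} \<union> N\<close> is a Borel set that encloses \<open>E\<close> and exceeds it only inside \<open>N\<close>.

  The topology enters only through its Borel \<open>\<sigma>\<close>-algebra, so the lemmas are about an arbitrary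
  \<open>\<sigma>\<close>-algebra, that of a measure space \<open>A\<close>, contained in that of \<open>M\<close>.
\<close>

lemma space_borel_of: "space (borel_of T) = topspace T"
  by (simp add: borel_of_def space_measure_of_conv)

text \<open>
  A cover of equal measure has a null excess only when that measure is finite: a subset of infinite
  measure may be covered by the whole space. Hence the detour through pieces of finite measure,
  whose covers overlap in general but still have a union with null excess.
\<close>

lemma (in sigma_finite_measure) measurable_set_cover_null_excess:
  assumes sub: "sets A \<subseteq> sets M"
    and outer: "\<And>E. E \<in> sets M \<Longrightarrow> \<exists>B\<in>sets A. E \<subseteq> B \<and> emeasure M B = emeasure M E"
    and E: "E \<in> sets M"
  obtains B where "B \<in> sets A" "E \<subseteq> B" "B - E \<in> null_sets M"
proof -
  obtain P :: "nat \<Rightarrow> 'a set" where P: "range P \<subseteq> sets M" "(\<Union>i. P i) = space M"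
    "\<And>i. emeasure M (P i) \<noteq> \<infinity>"
    using sigma_finite by metis
  have EP: "E \<inter> P i \<in> sets M" for i
    using P(1) E by blast
  obtain C where C: "\<And>i. C i \<in> sets A" "\<And>i. E \<inter> P i \<subseteq> C i"
    "\<And>i. emeasure M (C i) = emeasure M (E \<inter> P i)"
    using outer[OF EP] by metis
  have fin: "emeasure M (E \<inter> P i) \<noteq> \<infinity>" for i
    using emeasure_mono[of "E \<inter> P i" "P i" M] P(1) P(3)[of i]
    by (auto simp: top_unique)
  have null: "C i - E \<inter> P i \<in> null_sets M" for i
  proof (rule null_setsI)
    have "C i \<in> sets M"
      using C(1) sub by blast
    then show "C i - E \<inter> P i \<in> sets M"
      using EP by blast
    show "emeasure M (C i - E \<inter> P i) = 0"
      unfolding emeasure_Diff[OF fin \<open>C i \<in> sets M\<close> EP C(2)] C(3)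
      using fin[of i] by (intro diff_eq_0_ennreal) (simp_all add: top.not_eq_extremum)
  qed
  show thesis
  proof
    show "(\<Union>i. C i) \<in> sets A"
      using C(1) by blast
    then have "(\<Union>i. C i) \<in> sets M"
      using sub by blast
    show "E \<subseteq> (\<Union>i. C i)"
    proof
      fix x
      assume "x \<in> E"
      then have "x \<in> (\<Union>i. P i)"
        using P(2) sets.sets_into_space[OF E] by auto
      with \<open>x \<in> E\<close> C(2) show "x \<in> (\<Union>i. C i)"
        by fast
    qed
    show "(\<Union>i. C i) - E \<in> null_sets M"
    proof (rule null_sets_subset)
      show "(\<Union>i. C i - E \<inter> P i) \<in> null_sets M"
        using null by (rule null_sets_UN)
      show "(\<Union>i. C i) - E \<in> sets M"
        using \<open>(\<Union>i. C i) \<in> sets M\<close> E by blast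
    qed auto
  qed
qed

text \<open>
  The excess \<open>B - E\<close> of the cover need not be in \<open>A\<close>, so it is covered in turn by a null set of
  \<open>A\<close>.
\<close>

lemma (in sigma_finite_measure) measurable_set_eq_off_null:
  assumes sub: "sets A \<subseteq> sets M"
    and outer: "\<And>E. E \<in> sets M \<Longrightarrow> \<exists>B\<in>sets A. E \<subseteq> B \<and> emeasure M B = emeasure M E"
    and E: "E \<in> sets M"
  shows "\<exists>N B. N \<in> sets A \<and> B \<in> sets A \<and> emeasure M N = 0 \<and> E - N = B - N"
proof -
  obtain B where B: "B \<in> sets A" "E \<subseteq> B" "B - E \<in> null_sets M"
    using measurable_set_cover_null_excess[OF assms] by blast
  obtain N where "N \<in> sets A" "B - E \<subseteq> N" "emeasure M N = 0"
    using outer[of "B - E"] B(3) by (metis null_setsD1 null_setsD2)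
  with B show ?thesis
    by blast
qed

text \<open>
  A countable base of the codomain reduces the statement to countably many sets: preimages of basic
  open sets determine measurability, and countably many exceptional null sets still have a null
  union.
\<close>

lemma measurable_function_eq_off_null:
  fixes u :: "'a \<Rightarrow> 'b::second_countable_topology"
  assumes sub: "sets A \<subseteq> sets M" and space: "space A = space M"
    and eq_off_null: "\<And>E. E \<in> sets M \<Longrightarrow>
      \<exists>N B. N \<in> sets A \<and> B \<in> sets A \<and> emeasure M N = 0 \<and> E - N = B - N"
    and u: "u \<in> borel_measurable M"
  obtains N f where "N \<in> sets A" "f \<in> borel_measurable A" "emeasure M N = 0"
    "\<And>x. x \<in> space A - N \<Longrightarrow> f x = u x"
proof -
  obtain \<B> :: "'b set set" where \<B>: "countable \<B>" "topological_basis \<B>"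
    using ex_countable_basis by blast
  have pre: "u -` G \<inter> space M \<in> sets M" if "G \<in> \<B>" for G
    using that u \<B>(2) by (auto intro: measurable_sets borel_open topological_basis_open)
  obtain Z C where ZC: "\<And>G. G \<in> \<B> \<Longrightarrow> Z G \<in> sets A" "\<And>G. G \<in> \<B> \<Longrightarrow> C G \<in> sets A"
    "\<And>G. G \<in> \<B> \<Longrightarrow> emeasure M (Z G) = 0"
    "\<And>G. G \<in> \<B> \<Longrightarrow> u -` G \<inter> space M - Z G = C G - Z G"
    using eq_off_null[OF pre] by metis
  define N where "N = (\<Union>G\<in>\<B>. Z G)"
  have N: "N \<in> sets A"
    unfolding N_def using \<B>(1) ZC(1) by (rule sets.countable_UN'')
  have "N \<in> null_sets M"
    unfolding N_def using \<B>(1) ZC(1,3) sub by (intro null_sets_UN') auto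
  define f where "f x = (if x \<in> N then undefined else u x)" for x
  have "f -` G \<inter> space A \<in> sets A" if "G \<in> \<B>" for G
  proof -
    have "u -` G \<inter> space M - N = C G - N"
      using ZC(4)[OF that] that unfolding N_def by blast
    then have "f -` G \<inter> space A = (C G - N) \<union> (if undefined \<in> G then N else {})"
      using sets.sets_into_space[OF N] space by (auto simp: f_def split: if_splits)
    then show ?thesis
      using N ZC(2)[OF that] by auto
  qed
  then have "f \<in> borel_measurable A"
    unfolding borel_eq_countable_basis[OF \<B>] by (intro measurable_measure_of) auto
  with N \<open>N \<in> null_sets M\<close> show thesis
    by (intro that[of N f]) (auto simp: f_def)
qed

text \<open>
  Nothing is known about \<open>f\<close> on \<open>N\<close>, so \<open>{f = 1}\<close> may miss points of \<open>E\<close> there; adding all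
  of \<open>N\<close> repairs this without changing the measure.
\<close>

lemma indicator_eq_off_null_imp_measurable_cover:
  fixes f :: "'a \<Rightarrow> ereal"
  assumes sub: "sets A \<subseteq> sets M" and space: "space A = space M"
    and E: "E \<in> sets M"
    and N: "N \<in> sets A" "emeasure M N = 0"
    and f: "f \<in> borel_measurable A"
    and eq: "\<And>x. x \<in> space A - N \<Longrightarrow> f x = indicator E x"
  shows "\<exists>B\<in>sets A. E \<subseteq> B \<and> emeasure M B = emeasure M E"
proof (intro bexI conjI)
  let ?B = "(f -` {1} \<inter> space A) \<union> N"
  show B: "?B \<in> sets A"
    using N(1) f by (auto intro!: measurable_sets)
  show EB: "E \<subseteq> ?B"
    using sets.sets_into_space[OF E] eq by (auto simp: space)
  have NM: "N \<in> null_sets M"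
    using N sub by auto
  have "?B \<subseteq> E \<union> N"
    using eq by (auto simp: indicator_def split: if_splits)
  then have "emeasure M ?B \<le> emeasure M (E \<union> N)"
    using E NM by (intro emeasure_mono) auto
  also have "\<dots> = emeasure M E"
    using E NM by (rule emeasure_Un_null_set)
  finally show "emeasure M ?B = emeasure M E"
    using emeasure_mono[OF EB] B sub by (meson antisym subsetD)
qed

theorem theorem5p1:
  fixes T :: "'a topology" and M :: "'a measure"
  assumes "topological_measure_space T M"
    and "sigma_finite_measure M"
  shows "borel_regular T M \<longleftrightarrow>
    (\<forall>u :: 'a \<Rightarrow> ereal. u \<in> borel_measurable M \<longrightarrow>
      (\<exists>N f. N \<in> sets (borel_of T) \<and> f \<in> borel_measurable (borel_of T) \<and>
        emeasure M N = 0 \<and> (\<forall>x \<in> topspace T - N. f x = u x)))"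
    (is "_ \<longleftrightarrow> (\<forall>u. _ \<longrightarrow> ?borel_off_null u)")
proof
  interpret topological_measure_space T M by fact
  have space: "space (borel_of T) = space M"
    by (simp add: space_borel_of space_eq)
  show "\<forall>u. u \<in> borel_measurable M \<longrightarrow> ?borel_off_null u" if "borel_regular T M"
  proof (intro allI impI)
    fix u :: "'a \<Rightarrow> ereal"
    assume u: "u \<in> borel_measurable M"
    have outer: "\<exists>B\<in>sets (borel_of T). E \<subseteq> B \<and> emeasure M B = emeasure M E" if "E \<in> sets M" for E
      using \<open>borel_regular T M\<close> that unfolding borel_regular_def by blast
    note eq_off_null = sigma_finite_measure.measurable_set_eq_off_null[OF assms(2) borel_subset outer]
    obtain N f where "N \<in> sets (borel_of T)" "f \<in> borel_measurable (borel_of T)"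
      "emeasure M N = 0" "\<And>x. x \<in> space (borel_of T) - N \<Longrightarrow> f x = u x"
      using measurable_function_eq_off_null[OF borel_subset space eq_off_null u] by metis
    then show "?borel_off_null u"
      unfolding space_borel_of by blast
  qed
  show "borel_regular T M" if off_null: "\<forall>u. u \<in> borel_measurable M \<longrightarrow> ?borel_off_null u"
    unfolding borel_regular_def
  proof
    fix E
    assume E: "E \<in> sets M"
    then have "?borel_off_null (indicator E)"
      using off_null by simp
    then show "\<exists>B\<in>sets (borel_of T). E \<subseteq> B \<and> emeasure M B = emeasure M E"
      using indicator_eq_off_null_imp_measurable_cover[OF borel_subset space E]
      unfolding space_borel_of by blast
  qed
qed

end
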